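(* Let $n\ge 1$, let $\alpha$ be a unitary $n\times n$ matrix, and let $B_1,B_2\in\mathscr{S}_n(\mathbb{C}^+)$ be equivalent in the sense that $B_1(w)=RB_2(w)Q$ for all $w\in\mathbb{C}^+$, where $R,Q$ are fixed constant unitary $n\times n$ matrices. Then the Lebesgue weights of the absolutely continuous parts of the associated Clark measures satisfy $$\frac{d\mu^{B_1\alpha^*}}{dm}(s)=R\,\frac{d\mu^{B_2(Q\alpha^*R)}}{dm}(s)\,R^*$$ for (Lebesgue-almost) every $s\in\mathbb{R}$.
   Context: $\mathbb{C}^+$ is the open upper half-plane, $\mathbb{D}$ the open unit disk, $\mathbb{T}$ the unit circle, $m$ Lebesgue measure on $\mathbb{R}$. For an open set $X\subset\mathbb{C}$, $\mathscr{S}_n(X)$ denotes the set of contractive $n\times n$ matrix-valued analytic functions on $X$. The Cayley transform is $\gamma(w)=\frac{w-i}{w+i}$, a bijection of $\mathbb{C}^+$ onto $\mathbb{D}$ extending to a bijection of $\mathbb{R}$ onto $\mathbb{T}\setminus\{1\}$. For $B\in\mathscr{S}_n(\mathbb{C}^+)$ and a unitary matrix $\beta$, let $b\in\mathscr{S}_n(\mathbb{D})$ be defined by $B(w)=b(\gamma(w))$. It is understood that $I-b(\zeta)\beta^*$ is invertible for $\zeta\in\mathbb{D}$ whenever the Clark measure with parameter $\beta$ is considered: $\mu^{b\beta^*}$ is the unique nonnegative $n\times n$ matrix-valued Borel measure on $\mathbb{T}$ with $$\operatorname{Re}\big[(I-b(\zeta)\beta^* )^{-1}(I+b(\zeta)\beta^*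 )\big]=\int_{\mathbb{T}}\frac{1-|\zeta|^2}{|\lambda-\zeta|^2}\,\mu^{b\beta^*}(d\lambda),\quad \zeta\in\mathbb{D},$$ where $\operatorname{Re}X=\frac12(X+X^* )$. The Clark measure on the line is normalized as $\mu^{B\beta^*}(\Omega)=\mu^{b\beta^*}(\gamma(\Omega))$ for Borel $\Omega\subseteq\mathbb{R}$. The notation $\mu^{B_2(Q\alpha^*R)}$ means $\mu^{B_2\beta^*}$ with $\beta=R^*\alpha Q^*$, so that $\beta^*=Q\alpha^*R$. The "Lebesgue weight" $\frac{d\mu}{dm}$ is the density with respect to $m$ of the absolutely continuous part of $\mu$. *)

theory Defs
  imports "HOL-Complex_Analysis.Complex_Analysis"
begin

definition cadjoint :: "complex^'n^'m \<Rightarrow> complex^'m^'n" where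
  "cadjoint A = (\<chi> i j. cnj (A $ j $ i))"

definition unitary_matrix :: "complex^'n^'n \<Rightarrow> bool" where
  "unitary_matrix U \<longleftrightarrow> cadjoint U ** U = mat 1 \<and> U ** cadjoint U = mat 1"

definition Re_matrix :: "complex^'n^'n \<Rightarrow> complex^'n^'n" where
  "Re_matrix X = (1/2) *\<^sub>R (X + cadjoint X)"

definition schur_class :: "complex set \<Rightarrow> (complex \<Rightarrow> complex^'n^'n) set" where
  "schur_class X = {F. (\<forall>i j. (\<lambda>z. F z $ i $ j) holomorphic_on X) \<and>
                       (\<forall>z\<in>X. onorm ((*v) (F z)) \<le> 1)}"

(* The complex number x\<^sup>* A x. *)
definition qform :: "complex^'n^'n \<Rightarrow> complex^'n \<Rightarrow> complex" where
  "qform A x = (\<Sum>i\<in>UNIV. cnj (x $ i) * (A *v x) $ i)"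

(* Over the complex numbers this includes that A is Hermitian. *)
definition psd_matrix :: "complex^'n^'n \<Rightarrow> bool" where
  "psd_matrix A \<longleftrightarrow> (\<forall>x. qform A x \<in> \<real>\<^sub>\<ge>\<^sub>0)"

(* A measure with nonnegative matrix values on the measurable space underlying M
   (the measure carried by M is irrelevant).  Being matrix-valued, it is finite;
   the value on the empty set is 0 because the constant series has to converge.
   Values outside the sigma-algebra are unspecified. *)
definition nonneg_matrix_measure :: "'a measure \<Rightarrow> ('a set \<Rightarrow> complex^'n^'n) \<Rightarrow> bool" where
  "nonneg_matrix_measure M \<mu> \<longleftrightarrow>
     (\<forall>\<Omega>\<in>sets M. psd_matrix (\<mu> \<Omega>)) \<and>
     (\<forall>A::nat \<Rightarrow> 'a set. range A \<subseteq> sets M \<longrightarrow> disjoint_family A \<longrightarrow>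
        (\<lambda>k. \<mu> (A k)) sums \<mu> (\<Union>k. A k))"

(* The finite scalar measure x\<^sup>* \<mu>(.) x. *)
definition scalar_measure ::
    "'a measure \<Rightarrow> ('a set \<Rightarrow> complex^'n^'n) \<Rightarrow> complex^'n \<Rightarrow> 'a measure" where
  "scalar_measure M \<mu> x =
     measure_of (space M) (sets M) (\<lambda>\<Omega>. ennreal (Re (qform (\<mu> \<Omega>) x)))"

(* The integral of a real function f against a nonnegative matrix-valued measure is the
   matrix J with x\<^sup>* J x = \<integral> f d(x\<^sup>* \<mu> x) for all vectors x; by polarization there is at
   most one such J, and its entries are the integrals of f against the entries of \<mu>. *)
definition matrix_has_integral ::
    "'a measure \<Rightarrow> ('a set \<Rightarrow> complex^'n^'n) \<Rightarrow> ('a \<Rightarrow> real) \<Rightarrow> complex^'n^'n \<Rightarrow> bool" where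
  "matrix_has_integral M \<mu> f J \<longleftrightarrow>
     (\<forall>x. integrable (scalar_measure M \<mu> x) f \<and>
          qform J x = complex_of_real (\<integral>t. f t \<partial>scalar_measure M \<mu> x))"

abbreviation unit_circle :: "complex measure" where
  "unit_circle \<equiv> restrict_space borel (sphere 0 1)"

(* \<mu> is the Clark measure of b with parameter \<beta>, i.e. \<mu>\<^bsup>b\<beta>*\<^esup>. *)
definition is_clark_measure ::
    "(complex \<Rightarrow> complex^'n^'n) \<Rightarrow> complex^'n^'n \<Rightarrow> (complex set \<Rightarrow> complex^'n^'n) \<Rightarrow> bool" where
  "is_clark_measure b \<beta> \<mu> \<longleftrightarrow>
     nonneg_matrix_measure unit_circle \<mu> \<and>
     (\<forall>\<zeta>\<in>ball 0 1.
        invertible (mat 1 - b \<zeta> ** cadjoint \<beta>) \<and>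
        matrix_has_integral unit_circle \<mu>
          (\<lambda>t. (1 - (norm \<zeta>)\<^sup>2) / (norm (t - \<zeta>))\<^sup>2)
          (Re_matrix (matrix_inv (mat 1 - b \<zeta> ** cadjoint \<beta>) ** (mat 1 + b \<zeta> ** cadjoint \<beta>))))"

definition upper_halfplane :: "complex set" where
  "upper_halfplane = {w. Im w > 0}"

definition cayley :: "complex \<Rightarrow> complex" where
  "cayley w = (w - \<i>) / (w + \<i>)"

definition to_disk :: "(complex \<Rightarrow> complex^'n^'n) \<Rightarrow> complex \<Rightarrow> complex^'n^'n" where
  "to_disk B \<zeta> = B (inv_into upper_halfplane cayley \<zeta>)"

definition is_clark_measure_line ::
    "(complex \<Rightarrow> complex^'n^'n) \<Rightarrow> complex^'n^'n \<Rightarrow> (real set \<Rightarrow> complex^'n^'n) \<Rightarrow> bool" where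
  "is_clark_measure_line B \<beta> \<nu> \<longleftrightarrow>
     (\<exists>\<mu>. is_clark_measure (to_disk B) \<beta> \<mu> \<and>
          (\<forall>\<Omega>\<in>sets borel. \<nu> \<Omega> = \<mu> ((\<lambda>s. cayley (complex_of_real s)) ` \<Omega>)))"

(* W is (a version of) the density of the absolutely continuous part in the Lebesgue
   decomposition \<nu> = W dm + \<sigma>, with \<sigma> concentrated on a Lebesgue-null set N. *)
definition is_lebesgue_weight ::
    "(real set \<Rightarrow> complex^'n^'n) \<Rightarrow> (real \<Rightarrow> complex^'n^'n) \<Rightarrow> bool" where
  "is_lebesgue_weight \<nu> W \<longleftrightarrow>
     integrable lborel W \<and>
     (\<exists>\<sigma>. nonneg_matrix_measure borel \<sigma> \<and>
          (\<exists>N\<in>null_sets lborel. \<forall>\<Omega>\<in>sets borel. \<sigma> \<Omega> = \<sigma> (\<Omega> \<inter> N)) \<and>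
          (\<forall>\<Omega>\<in>sets borel. \<nu> \<Omega> = (LINT s:\<Omega>|lborel. W s) + \<sigma> \<Omega>))"

end

theory Submission
  imports Defs
begin

unbundle no fps_syntax

text \<open>
  With \<open>\<beta>\<^sup>* = Q \<alpha>\<^sup>* R\<close> one has \<open>B\<^sub>1 \<alpha>\<^sup>* = R (B\<^sub>2 \<beta>\<^sup>*) R\<^sup>*\<close>, and conjugation by the unitary
  matrix \<open>R\<close> passes through \<open>X \<mapsto> Re ((I - X)\<^sup>-\<^sup>1 (I + X))\<close>.  Hence the scalar measures
  \<open>x\<^sup>* \<mu>\<^sub>1 x\<close> and \<open>(R\<^sup>* x)\<^sup>* \<mu>\<^sub>2 (R\<^sup>* x)\<close> on the circle have the same Poisson integral.  A finite
  measure on the circle is determined by its Poisson integral: the difference of the two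
  Herglotz power series has zero real part, so all moments agree, and trigonometric polynomials
  are dense in the continuous functions.  By polarization \<open>\<mu>\<^sub>1 = R \<mu>\<^sub>2 R\<^sup>*\<close>, and uniqueness of
  the Lebesgue decomposition transfers this to the densities.
\<close>

section \<open>Finite measures on the circle are determined by their Poisson integral\<close>

text \<open>Closed sets form an intersection-stable generator of the Borel sets, and the indicator
  of a closed set is a pointwise limit of continuous functions with values in [0, 1], so dominated
  convergence carries equality of integrals over to equality of measures.\<close>

lemma finite_measure_eqI_continuous:
  fixes M N :: "'a::metric_space measure"
  assumes M: "finite_measure M" "sets M = sets borel"
    and N: "finite_measure N" "sets N = sets borel"
    and eq: "\<And>f::'a \<Rightarrow> real. continuous_on UNIV f \<Longrightarrow> (\<And>x. \<bar>f x\<bar> \<le> 1) \<Longrightarrow>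
               (\<integral>x. f x \<partial>M) = (\<integral>x. f x \<partial>N)"
  shows "M = N"
proof (rule measure_eqI_generator_eq[where E="Collect closed" and \<Omega>=UNIV and A="\<lambda>_. UNIV"])
  show "Int_stable (Collect closed :: 'a set set)"
    by (auto simp: Int_stable_def)
  show "sets M = sigma_sets UNIV (Collect closed)" "sets N = sigma_sets UNIV (Collect closed)"
    using M(2) N(2) by (simp_all add: borel_eq_closed)
  show "emeasure M UNIV \<noteq> \<infinity>"
    using M by (simp add: finite_measure.emeasure_finite)
  fix C :: "'a set" assume "C \<in> Collect closed"
  then have C: "closed C" by simp
  show "emeasure M C = emeasure N C"
  \<comment> \<open>The empty set is treated apart because \<open>infdist x {}\<close> is 0 by
    convention, which would make every \<open>f k\<close> constantly 1.\<close>
  proof (cases "C = {}")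
    case False
    \<comment> \<open>For positive \<open>k\<close>, this is 1 on \<open>C\<close> and falls
      linearly to 0 at distance \<open>1/k\<close> from \<open>C\<close>.\<close>
    define f where "f k x = max 0 (1 - real k * infdist x C)" for k x
    have f_cont: "continuous_on UNIV (f k)" for k
      unfolding f_def by (intro continuous_intros)
    have f_bound: "\<bar>f k x\<bar> \<le> 1" for k x
      by (simp add: f_def infdist_nonneg)
    have f_lim: "(\<lambda>k. f k x) \<longlonglongrightarrow> indicator C x" for x
    proof (cases "x \<in> C")
      case True
      then show ?thesis by (simp add: f_def)
    next
      case x: False
      then have "infdist x C > 0"
        using C False in_closed_iff_infdist_zero[of C x] infdist_nonneg[of x C] by auto
      then obtain K :: nat where K: "1 < real K * infdist x C"
        using reals_Archimedean3 by blast
      have "f k x = 0" if "k \<ge> K" for k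
      proof -
        have "real K * infdist x C \<le> real k * infdist x C"
          using that by (intro mult_right_mono) (auto simp: infdist_nonneg)
        then show ?thesis using K by (simp add: f_def)
      qed
      then have "eventually (\<lambda>k. f k x = 0) sequentially"
        unfolding eventually_sequentially by blast
      then show ?thesis using x by (simp add: tendsto_eventually)
    qed
    have lim: "(\<lambda>k. \<integral>x. f k x \<partial>L) \<longlonglongrightarrow> measure L C"
      if "finite_measure L" "sets L = sets borel" for L
    proof -
      interpret finite_measure L by fact
      have CL: "C \<in> sets L" using C that(2) by simp
      have "(\<lambda>k. \<integral>x. f k x \<partial>L) \<longlonglongrightarrow> (\<integral>x. indicator C x \<partial>L)"
      proof (rule integral_dominated_convergence[where w="\<lambda>_. 1"])
        show "indicator C \<in> borel_measurable L"
          by (rule borel_measurable_indicator[OF CL])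
        show "f k \<in> borel_measurable L" for k
          using borel_measurable_continuous_onI[OF f_cont[of k]]
          by (simp add: measurable_cong_sets[OF that(2) refl])
      qed (use f_bound f_lim in auto)
      then show ?thesis using CL by simp
    qed
    have "(\<lambda>k. \<integral>x. f k x \<partial>M) = (\<lambda>k. \<integral>x. f k x \<partial>N)"
      using eq f_cont f_bound by (intro ext) blast
    then have "measure M C = measure N C"
      using lim[OF M] lim[OF N] LIMSEQ_unique by metis
    then show ?thesis
      using M N by (simp add: finite_measure.emeasure_eq_measure)
  qed simp
qed auto

section \<open>Real polynomials on the circle and power series with vanishing real part\<close>

lemma real_polynomial_function_on_sphere:
  fixes g :: "complex \<Rightarrow> real"
  assumes "real_polynomial_function g"
  obtains p n where "\<And>z. norm z = 1 \<Longrightarrow> of_real (g z) * z ^ n = poly p z"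
proof -
  have "\<exists>p n. \<forall>z. norm z = 1 \<longrightarrow> of_real (g z) * z ^ n = poly p z"
    using assms
  proof (induction rule: real_polynomial_function.induct)
    case (linear f)
    define a b :: complex where "a = of_real (f 1)" and "b = of_real (f \<i>)"
    \<comment> \<open>The coefficients come from Re z = (z + 1/z)/2 and Im z = \<i>(1/z - z)/2 on
      the circle, after multiplication by \<open>z\<close>.\<close>
    have "of_real (f z) * z ^ 1 = poly [:a/2 + \<i>*b/2, 0, a/2 - \<i>*b/2:] z"
      if z: "norm z = 1" for z
    proof -
      have "z = Re z *\<^sub>R 1 + Im z *\<^sub>R \<i>"
        by (simp add: complex_eq_iff)
      then have "f z = f (Re z *\<^sub>R 1 + Im z *\<^sub>R \<i>)"
        by (rule arg_cong)
      also have "\<dots> = Re z * f 1 + Im z * f \<i>"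
        using linear by (simp only: linear_add linear_scale bounded_linear.linear real_scaleR_def)
      finally have f: "complex_of_real (f z) = Re z * a + Im z * b"
        by (simp add: a_def b_def)
      have 1: "z * cnj z = 1"
        using z by (simp add: complex_norm_square[symmetric])
      have re: "complex_of_real (Re z) = (z + cnj z) / 2"
        by (simp add: complex_add_cnj)
      have im: "complex_of_real (Im z) = \<i> * (cnj z - z) / 2"
        by (simp add: complex_eq_iff)
      have "of_real (f z) * z = a * (z * z + z * cnj z) / 2 + \<i> * b * (z * cnj z - z * z) / 2"
        unfolding f re im by (simp add: field_simps)
      then show ?thesis
        unfolding 1 by (simp add: field_simps)
    qed
    then show ?case by blast
  next
    case (const c)
    have "of_real c * z ^ 0 = poly [:of_real c:] z" for z :: complex by simp
    then show ?case by blast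
  next
    case (add f g)
    then obtain p n q m where
      p: "\<And>z. norm z = 1 \<Longrightarrow> of_real (f z) * z ^ n = poly p z" and
      q: "\<And>z. norm z = 1 \<Longrightarrow> of_real (g z) * z ^ m = poly q z"
      by blast
    \<comment> \<open>Each summand is multiplied by the power that clears the other one, which gives
      the common exponent \<open>n + m\<close>.\<close>
    have "of_real (f z + g z) * z ^ (n + m) = poly (p * monom 1 m + q * monom 1 n) z"
      if "norm z = 1" for z
      using that by (simp add: p[symmetric] q[symmetric] poly_monom power_add algebra_simps)
    then show ?case by blast
  next
    case (mult f g)
    then obtain p n q m where
      p: "\<And>z. norm z = 1 \<Longrightarrow> of_real (f z) * z ^ n = poly p z" and
      q: "\<And>z. norm z = 1 \<Longrightarrow> of_real (g z) * z ^ m = poly q z"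
      by blast
    have "of_real (f z * g z) * z ^ (n + m) = poly (p * q) z"
      if "norm z = 1" for z
      using that by (simp add: p[symmetric] q[symmetric] power_add algebra_simps)
    then show ?case by blast
  qed
  then show ?thesis using that by blast
qed

text \<open>An analytic function with values on the imaginary axis has no open image, so it is
  constant. The condition on \<open>a 0\<close> fixes the imaginary constant, which the real part
  cannot detect.\<close>

lemma powser_Re_zero:
  fixes a :: "nat \<Rightarrow> complex"
  assumes sums: "\<And>z. norm z < 1 \<Longrightarrow> (\<lambda>n. a n * z ^ n) sums f z"
    and Re: "\<And>z. norm z < 1 \<Longrightarrow> Re (f z) = 0"
    and a0: "a 0 = 0"
  shows "a n = 0"
proof (rule ccontr)
  assume n: "a n \<noteq> 0"
  then have "n > 0" using a0 by (cases n) auto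
  have f0: "f 0 = 0"
    using sums[of 0] a0 by simp
  have hol: "f holomorphic_on ball 0 1"
    by (rule power_series_holomorphic[where a=a]) (use sums in auto)
  have "f constant_on ball 0 1"
  proof (rule ccontr)
    assume "\<not> f constant_on ball 0 1"
    then have "open (f ` ball 0 1)"
      by (intro open_mapping_thm[OF hol]) auto
    moreover have "0 \<in> f ` ball 0 1"
      using f0 by (force intro: image_eqI[of _ _ 0])
    \<comment> \<open>An open image containing 0 also contains a positive real number, whose real
      part is not 0.\<close>
    ultimately obtain e where e: "e > 0" "ball 0 e \<subseteq> f ` ball 0 1"
      using open_contains_ball by blast
    then have "complex_of_real (e/2) \<in> f ` ball 0 1" by auto
    then obtain z where "norm z < 1" "f z = complex_of_real (e/2)" by auto
    then show False using Re[of z] e by (metis Re_complex_of_real half_gt_zero less_irrefl)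
  qed
  then have f: "f z = 0" if "norm z < 1" for z
    using that f0 unfolding constant_on_def
    by (metis mem_ball_0 norm_zero zero_less_one)
  obtain s where s: "0 < s" "\<And>z. z \<in> cball 0 s - {0} \<Longrightarrow> f z \<noteq> 0"
    using powser_0_nonzero[of 1 0 a f n] sums f0 n \<open>n > 0\<close> by auto
  \<comment> \<open>The minimum with 1/2 keeps the point inside the unit disk, where
    \<open>f\<close> vanishes, as well as in the punctured disk where \<open>f\<close> has no
    zero.\<close>
  have "f (of_real (min s (1/2))) \<noteq> 0"
    using s by (intro s(2)) auto
  moreover have "f (of_real (min s (1/2))) = 0"
    using s by (intro f) auto
  ultimately show False by simp
qed

section \<open>Poisson integral and moments of one measure on the circle\<close>

abbreviation poisson :: "complex \<Rightarrow> complex \<Rightarrow> real" where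
  "poisson \<zeta> t \<equiv> (1 - (norm \<zeta>)\<^sup>2) / (norm (t - \<zeta>))\<^sup>2"

text \<open>This exhibits the kernel as the real part of a function analytic in \<zeta>, which can
  be expanded in a geometric series. The key identity is
  \<open>t - \<zeta> = t * (1 - \<zeta> * cnj t)\<close> on the circle.\<close>

lemma poisson_eq_Re:
  assumes t: "norm t = 1" and z: "norm \<zeta> < 1"
  shows "poisson \<zeta> t = 2 * Re (1 / (1 - \<zeta> * cnj t)) - 1"
proof -
  let ?w = "\<zeta> * cnj t"
  have w: "norm ?w = norm \<zeta>" using t by (simp add: norm_mult)
  define D where "D = (norm (1 - ?w))\<^sup>2"
  have "t - \<zeta> = t * (1 - ?w)"
    using t by (simp add: algebra_simps complex_norm_square[symmetric])
  then have norm: "(norm (t - \<zeta>))\<^sup>2 = D"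
    using t by (simp add: norm_mult D_def)
  have D0: "D \<noteq> 0"
    using w z by (auto simp: D_def)
  have Re: "Re (1 / (1 - ?w)) = (1 - Re ?w) / D"
    by (simp add: Re_divide cmod_power2 D_def)
  have "D = 1 - 2 * Re ?w + (norm \<zeta>)\<^sup>2"
    unfolding w[symmetric] cmod_power2 D_def by (simp add: power2_eq_square algebra_simps)
  then have "1 - (norm \<zeta>)\<^sup>2 = 2 * (1 - Re ?w) - D" by simp
  then have "poisson \<zeta> t = (2 * (1 - Re ?w) - D) / D" by (simp only: norm)
  also have "\<dots> = 2 * Re (1 / (1 - ?w)) - 1"
    unfolding Re using D0 by (simp add: divide_simps)
  finally show ?thesis .
qed

locale finite_circle_measure = finite_measure M for M :: "complex measure" +
  assumes sets_M: "sets M = sets unit_circle"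
begin

lemma space_M: "space M = sphere 0 1"
  using sets_eq_imp_space_eq[OF sets_M] by (simp add: space_restrict_space)

lemma integrable_continuous:
  fixes f :: "complex \<Rightarrow> 'b::{banach, second_countable_topology}"
  assumes "continuous_on (sphere 0 1) f"
  shows "integrable M f"
proof -
  have "f \<in> borel_measurable M"
    using borel_measurable_continuous_on_restrict[OF assms] measurable_cong_sets[OF sets_M]
    by auto
  moreover obtain B where "\<forall>t\<in>sphere 0 1. norm (f t) \<le> B"
    using compact_imp_bounded[OF compact_continuous_image[OF assms compact_sphere]]
    unfolding bounded_iff by blast
  ultimately show ?thesis
    by (intro integrable_const_bound[of _ B]) (auto simp: space_M)
qed

text \<open>With conjugated powers these are the Taylor coefficients in \<zeta> of the integral of
  \<open>1 / (1 - \<zeta> * cnj t)\<close>. The moments of the powers of \<open>t\<close> are their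
  conjugates.\<close>

definition moment :: "nat \<Rightarrow> complex" where
  "moment k = (\<integral>t. cnj t ^ k \<partial>M)"

lemma integrable_monomial [simp]: "integrable M (\<lambda>t. c * (t ^ i * cnj t ^ j))" for c :: complex
  by (intro integrable_continuous continuous_intros)

text \<open>The geometric series is integrated term by term: on the circle its terms have norm
  \<open>norm \<zeta> ^ k\<close>, which is summable, and the measure is finite.\<close>

lemma moment_series:
  assumes z: "norm \<zeta> < 1"
  shows "(\<lambda>k. moment k * \<zeta> ^ k) sums (\<integral>t. 1 / (1 - \<zeta> * cnj t) \<partial>M)"
proof -
  have int: "integrable M (\<lambda>t. (\<zeta> * cnj t) ^ k)" for k
    by (intro integrable_continuous continuous_intros)
  have norm: "norm ((\<zeta> * cnj t) ^ k) = norm \<zeta> ^ k" if "t \<in> space M" for t k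
    using that by (simp add: space_M norm_mult norm_power)
  have sm: "summable (\<lambda>k. norm \<zeta> ^ k)" using z by (simp add: summable_geometric)
  have "(\<lambda>k. \<integral>t. (\<zeta> * cnj t) ^ k \<partial>M) sums (\<integral>t. (\<Sum>k. (\<zeta> * cnj t) ^ k) \<partial>M)"
  proof (rule sums_integral[OF int])
    show "AE t in M. summable (\<lambda>k. norm ((\<zeta> * cnj t) ^ k))"
      using norm sm by (intro AE_I2) simp
    have "(\<integral>t. norm ((\<zeta> * cnj t) ^ k) \<partial>M) = norm \<zeta> ^ k * measure M (space M)" for k
      using norm by (simp cong: Bochner_Integration.integral_cong)
    then show "summable (\<lambda>k. \<integral>t. norm ((\<zeta> * cnj t) ^ k) \<partial>M)"
      using sm by (simp add: summable_mult2)
  qed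
  moreover have "(\<integral>t. (\<Sum>k. (\<zeta> * cnj t) ^ k) \<partial>M) = (\<integral>t. 1 / (1 - \<zeta> * cnj t) \<partial>M)"
  proof (rule Bochner_Integration.integral_cong[OF refl])
    fix t assume "t \<in> space M"
    then have "norm (\<zeta> * cnj t) < 1" using z by (simp add: space_M norm_mult)
    then show "(\<Sum>k. (\<zeta> * cnj t) ^ k) = 1 / (1 - \<zeta> * cnj t)"
      using geometric_sums sums_unique by metis
  qed
  moreover have "(\<integral>t. (\<zeta> * cnj t) ^ k \<partial>M) = moment k * \<zeta> ^ k" for k
    by (simp add: moment_def power_mult_distrib)
  ultimately show ?thesis by simp
qed

lemma integral_poisson:
  assumes z: "norm \<zeta> < 1"
  shows "(\<integral>t. poisson \<zeta> t \<partial>M) = 2 * Re (\<integral>t. 1 / (1 - \<zeta> * cnj t) \<partial>M) - measure M (space M)"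
proof -
  have "1 - \<zeta> * cnj t \<noteq> 0" if "t \<in> sphere 0 1" for t
  proof
    assume "1 - \<zeta> * cnj t = 0"
    then have "norm (\<zeta> * cnj t) = 1" by (metis eq_iff_diff_eq_0 norm_one)
    then show False using that z by (simp add: norm_mult)
  qed
  then have int: "integrable M (\<lambda>t. 1 / (1 - \<zeta> * cnj t))"
    by (intro integrable_continuous continuous_intros) auto
  have "(\<integral>t. poisson \<zeta> t \<partial>M) = (\<integral>t. 2 * Re (1 / (1 - \<zeta> * cnj t)) - 1 \<partial>M)"
    using z by (intro Bochner_Integration.integral_cong refl poisson_eq_Re) (auto simp: space_M)
  also have "\<dots> = 2 * Re (\<integral>t. 1 / (1 - \<zeta> * cnj t) \<partial>M) - measure M (space M)"
    using int integrable_Re[OF int] by (simp add: integral_Re)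
  finally show ?thesis .
qed

text \<open>Since \<open>t * cnj t = 1\<close> on the circle, a mixed monomial collapses to a single
  power of \<open>cnj t\<close> or of \<open>t\<close>.\<close>

lemma integral_monomial:
  "(\<integral>t. t ^ i * cnj t ^ j \<partial>M) = (if i \<le> j then moment (j - i) else cnj (moment (i - j)))"
proof -
  have 1: "t ^ k * cnj t ^ k = 1" if "t \<in> space M" for t k
    using that by (simp add: space_M power_mult_distrib[symmetric] complex_norm_square[symmetric])
  show ?thesis
  proof (cases "i \<le> j")
    case True
    have "t ^ i * cnj t ^ j = cnj t ^ (j - i)" if "t \<in> space M" for t
    proof -
      have "t ^ i * cnj t ^ j = (t ^ i * cnj t ^ i) * cnj t ^ (j - i)"
        using True by (metis le_add_diff_inverse mult.assoc power_add)
      then show ?thesis by (simp add: 1[OF that])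
    qed
    then show ?thesis using True by (simp add: moment_def cong: Bochner_Integration.integral_cong)
  next
    case False
    have "t ^ i * cnj t ^ j = cnj (cnj t ^ (i - j))" if "t \<in> space M" for t
    proof -
      have "t ^ i * cnj t ^ j = (t ^ j * cnj t ^ j) * t ^ (i - j)"
        using False by (metis le_add_diff_inverse mult.assoc mult.commute nat_le_linear power_add)
      then show ?thesis by (simp add: 1[OF that])
    qed
    then have "(\<integral>t. t ^ i * cnj t ^ j \<partial>M) = (\<integral>t. cnj (cnj t ^ (i - j)) \<partial>M)"
      by (intro Bochner_Integration.integral_cong) auto
    also have "\<dots> = cnj (moment (i - j))"
      unfolding moment_def by (rule Bochner_Integration.integral_cnj)
    finally show ?thesis using False by simp
  qed
qed

end

section \<open>Two measures with equal Poisson integrals\<close>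

locale two_circle_measures =
  M: finite_circle_measure M + N: finite_circle_measure N for M N +
  assumes poisson_eq:
    "\<And>\<zeta>. norm \<zeta> < 1 \<Longrightarrow> (\<integral>t. poisson \<zeta> t \<partial>M) = (\<integral>t. poisson \<zeta> t \<partial>N)"
begin

text \<open>The Poisson kernel at \<zeta> = 0 is constantly 1 on the circle.\<close>

lemma measure_space_eq: "measure M (space M) = measure N (space N)"
proof -
  have "(\<integral>t. poisson 0 t \<partial>L) = measure L (space L)" if "finite_circle_measure L" for L
  proof -
    interpret finite_circle_measure L by fact
    have "(\<integral>t. poisson 0 t \<partial>L) = (\<integral>t. 1 \<partial>L)"
      by (intro Bochner_Integration.integral_cong) (auto simp: space_M)
    then show ?thesis by simp
  qed
  then show ?thesis
    using poisson_eq[of 0] M.finite_circle_measure_axioms N.finite_circle_measure_axioms by simp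
qed

text \<open>The difference of the two Herglotz series has zero real part, because the Poisson
  integrals and the total masses agree. Its constant term is the difference of the masses, so it is
  0 and no imaginary constant remains.\<close>

lemma moment_eq: "M.moment k = N.moment k"
proof -
  have "M.moment k - N.moment k = 0"
  proof (rule powser_Re_zero[where a="\<lambda>k. M.moment k - N.moment k"])
    fix \<zeta> :: complex assume z: "norm \<zeta> < 1"
    show "(\<lambda>k. (M.moment k - N.moment k) * \<zeta> ^ k) sums
        ((\<integral>t. 1 / (1 - \<zeta> * cnj t) \<partial>M) - (\<integral>t. 1 / (1 - \<zeta> * cnj t) \<partial>N))"
      using sums_diff[OF M.moment_series[OF z] N.moment_series[OF z]]
      by (simp add: left_diff_distrib)
    show "Re ((\<integral>t. 1 / (1 - \<zeta> * cnj t) \<partial>M) - (\<integral>t. 1 / (1 - \<zeta> * cnj t) \<partial>N)) = 0"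
      using poisson_eq[OF z] measure_space_eq M.integral_poisson[OF z] N.integral_poisson[OF z]
      by simp
  next
    show "M.moment 0 - N.moment 0 = 0"
      using measure_space_eq by (simp add: M.moment_def N.moment_def)
  qed
  then show ?thesis by simp
qed

lemma integral_real_polynomial_eq:
  assumes "real_polynomial_function g"
  shows "(\<integral>t. g t \<partial>M) = (\<integral>t. g t \<partial>N)"
proof -
  obtain p n where p: "\<And>z. norm z = 1 \<Longrightarrow> of_real (g z) * z ^ n = poly p z"
    using real_polynomial_function_on_sphere[OF assms] by blast
  \<comment> \<open>On the circle the factor \<open>t ^ n\<close> is undone by multiplying with
    \<open>cnj t ^ n\<close>, so \<open>g\<close> becomes a combination of monomials whose integrals
    are moments or their conjugates.\<close>
  have g: "complex_of_real (g t) = (\<Sum>i\<le>degree p. coeff p i * (t ^ i * cnj t ^ n))"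
    if "norm t = 1" for t
  proof -
    have "t ^ n * cnj t ^ n = 1"
      using that by (simp add: power_mult_distrib[symmetric] complex_norm_square[symmetric])
    then have "complex_of_real (g t) = poly p t * cnj t ^ n"
      using p[OF that] by (metis mult.assoc mult.right_neutral)
    then show ?thesis by (simp add: poly_altdef sum_distrib_right mult.assoc)
  qed
  have "complex_of_real (\<integral>t. g t \<partial>L) = (\<Sum>i\<le>degree p. coeff p i * (\<integral>t. t ^ i * cnj t ^ n \<partial>L))"
    if "finite_circle_measure L" for L
  proof -
    interpret finite_circle_measure L by fact
    have "complex_of_real (\<integral>t. g t \<partial>L) = (\<integral>t. complex_of_real (g t) \<partial>L)"
      by simp
    also have "\<dots> = (\<integral>t. (\<Sum>i\<le>degree p. coeff p i * (t ^ i * cnj t ^ n)) \<partial>L)"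
      using g by (intro Bochner_Integration.integral_cong) (auto simp: space_M)
    also have "\<dots> = (\<Sum>i\<le>degree p. coeff p i * (\<integral>t. t ^ i * cnj t ^ n \<partial>L))"
      by (subst Bochner_Integration.integral_sum) simp_all
    finally show ?thesis .
  qed
  moreover have "(\<integral>t. t ^ i * cnj t ^ n \<partial>M) = (\<integral>t. t ^ i * cnj t ^ n \<partial>N)" for i
    by (simp only: M.integral_monomial N.integral_monomial moment_eq)
  ultimately have "complex_of_real (\<integral>t. g t \<partial>M) = complex_of_real (\<integral>t. g t \<partial>N)"
    using M.finite_circle_measure_axioms N.finite_circle_measure_axioms by simp
  then show ?thesis by simp
qed

lemma integral_continuous_eq:
  fixes f :: "complex \<Rightarrow> real"
  assumes f: "continuous_on (sphere 0 1) f"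
  shows "(\<integral>t. f t \<partial>M) = (\<integral>t. f t \<partial>N)"
proof (rule ccontr)
  \<comment> \<open>Adding 1 to the common mass keeps \<open>K\<close> positive even for the zero
    measure. With approximation error \<open>d / (2 * K)\<close> the two errors then sum to
    \<open>d * ((K - 1) / K)\<close>, which is strictly below \<open>d\<close>.\<close>
  define K where "K = measure M (space M) + 1"
  assume "(\<integral>t. f t \<partial>M) \<noteq> (\<integral>t. f t \<partial>N)"
  define d where "d = \<bar>(\<integral>t. f t \<partial>M) - (\<integral>t. f t \<partial>N)\<bar>"
  have d: "d > 0" using \<open>_ \<noteq> _\<close> by (simp add: d_def)
  have K: "K > 0" by (simp add: K_def add_nonneg_pos)
  obtain g where g: "real_polynomial_function g"
      "\<And>t. t \<in> sphere 0 1 \<Longrightarrow> \<bar>f t - g t\<bar> < d / (2 * K)"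
    using Stone_Weierstrass_real_polynomial_function[OF compact_sphere f, of "d / (2 * K)"] d K
    by auto
  have close: "\<bar>(\<integral>t. f t \<partial>L) - (\<integral>t. g t \<partial>L)\<bar> \<le> d / (2 * K) * measure L (space L)"
    if "finite_circle_measure L" for L
  proof -
    interpret finite_circle_measure L by fact
    have int: "integrable L f" "integrable L g"
      using f g(1) by (auto intro!: integrable_continuous continuous_on_polymonial_function
          simp: real_polynomial_function_eq)
    then have "\<bar>(\<integral>t. f t \<partial>L) - (\<integral>t. g t \<partial>L)\<bar> = \<bar>\<integral>t. f t - g t \<partial>L\<bar>" by simp
    also have "\<dots> \<le> (\<integral>t. \<bar>f t - g t\<bar> \<partial>L)" by (rule integral_abs_bound)
    also have "\<dots> \<le> (\<integral>t. d / (2 * K) \<partial>L)"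
      using g(2) int by (intro integral_mono integrable_abs) (auto simp: space_M intro: less_imp_le)
    finally show ?thesis by (simp add: mult.commute)
  qed
  have "d \<le> d / (2 * K) * measure M (space M) + d / (2 * K) * measure N (space N)"
    using close[OF M.finite_circle_measure_axioms] close[OF N.finite_circle_measure_axioms]
      integral_real_polynomial_eq[OF g(1)] unfolding d_def by linarith
  also have "\<dots> = d * ((K - 1) / K)"
  proof -
    have "measure M (space M) = K - 1" by (simp add: K_def)
    then show ?thesis using K unfolding measure_space_eq[symmetric] by (auto simp: divide_simps algebra_simps)
  qed
  also have "\<dots> < d * 1"
    using K d by (intro mult_strict_left_mono) auto
  finally show False by simp
qed

text \<open>Both measures are pushed forward to the plane, where continuous functions separate
  finite measures. Every measurable subset of the circle is a Borel set of the plane, so the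
  push-forward loses nothing.\<close>

lemma measures_eq: "M = N"
proof -
  have incl: "(\<lambda>t. t) \<in> measurable L borel" if "sets L = sets unit_circle" for L :: "complex measure"
    using measurable_cong_sets[OF that refl, of borel] measurable_restrict_space1[of "\<lambda>t. t" borel borel] by auto
  note inclM = incl[OF M.sets_M] and inclN = incl[OF N.sets_M]
  have distr: "distr M borel (\<lambda>t. t) = distr N borel (\<lambda>t. t)"
  proof (rule finite_measure_eqI_continuous)
    fix f :: "complex \<Rightarrow> real" assume f: "continuous_on UNIV f"
    then have "f \<in> borel_measurable borel"
      by (rule borel_measurable_continuous_onI)
    then show "(\<integral>x. f x \<partial>distr M borel (\<lambda>t. t)) = (\<integral>x. f x \<partial>distr N borel (\<lambda>t. t))"
      using integral_continuous_eq[OF continuous_on_subset[OF f]]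
      by (simp add: integral_distr inclM inclN)
  qed (auto intro: M.finite_measure_distr N.finite_measure_distr inclM inclN)
  show ?thesis
  proof (rule measure_eqI)
    show "sets M = sets N" by (simp add: M.sets_M N.sets_M)
    fix A assume A: "A \<in> sets M"
    then have borel: "A \<in> sets borel" and "A \<subseteq> sphere 0 1"
      using sets_restrict_space_iff[of "sphere 0 1 :: complex set" borel A] by (auto simp: M.sets_M)
    then show "emeasure M A = emeasure N A"
      using arg_cong[OF distr, of "\<lambda>L. emeasure L A"] A
      by (simp add: emeasure_distr inclM inclN M.space_M N.space_M Int_absorb2)
  qed
qed

end

section \<open>Unitary congruence of matrices\<close>


lemma cadjoint_cadjoint [simp]: "cadjoint (cadjoint A) = A"
  by (simp add: cadjoint_def vec_eq_iff)

lemma cadjoint_mult: "cadjoint (A ** B) = cadjoint B ** cadjoint A"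
  by (simp add: cadjoint_def matrix_matrix_mult_def vec_eq_iff mult.commute)

lemma matrix_add_rdistrib:
  fixes A B :: "complex^'n^'m"
  shows "(A + B) ** C = A ** C + B ** C"
  by (simp add: matrix_matrix_mult_def vec_eq_iff distrib_right sum.distrib)

lemma Re_matrix_congruence:
  "Re_matrix (R ** X ** cadjoint R) = R ** Re_matrix X ** cadjoint R"
proof -
  have "cadjoint (R ** X ** cadjoint R) = R ** cadjoint X ** cadjoint R"
    by (simp add: cadjoint_mult matrix_mul_assoc)
  moreover have scale: "(1/2) *\<^sub>R (R ** Y ** cadjoint R) = R ** ((1/2) *\<^sub>R Y) ** cadjoint R"
    for Y
    by (simp add: matrix_matrix_mult_def vec_eq_iff scaleR_sum_right sum_distrib_right)
  ultimately show ?thesis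
    by (simp only: Re_matrix_def matrix_add_ldistrib matrix_add_rdistrib flip: scale)
qed

text \<open>Conjugation by \<open>R\<close> is traded for a change of test vector, so that scalar
  measures of the two matrix measures can be compared at \<open>x\<close> and at
  \<open>cadjoint R *v x\<close>.\<close>

lemma qform_congruence:
  "qform (R ** A ** cadjoint R) x = qform A (cadjoint R *v x)"
proof -
  define y where "y = A *v (cadjoint R *v x)"
  have "qform (R ** A ** cadjoint R) x = (\<Sum>i\<in>UNIV. cnj (x $ i) * (R *v y) $ i)"
    by (simp add: qform_def y_def matrix_vector_mul_assoc matrix_mul_assoc)
  also have "\<dots> = (\<Sum>i\<in>UNIV. \<Sum>k\<in>UNIV. cnj (x $ i) * R $ i $ k * y $ k)"
    by (simp add: matrix_vector_mult_def sum_distrib_left mult.assoc)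
  also have "\<dots> = (\<Sum>k\<in>UNIV. \<Sum>i\<in>UNIV. cnj (x $ i) * R $ i $ k * y $ k)"
    by (rule sum.swap)
  also have "\<dots> = (\<Sum>k\<in>UNIV. cnj ((cadjoint R *v x) $ k) * y $ k)"
    by (simp add: matrix_vector_mult_def cadjoint_def sum_distrib_right sum_distrib_left
        mult.commute mult.left_commute)
  finally show ?thesis by (simp add: qform_def y_def)
qed

lemma qform_diff: "qform (A - B) x = qform A x - qform B x"
  by (simp add: qform_def matrix_vector_mult_diff_rdistrib right_diff_distrib sum_subtractf)

text \<open>Polarization with the test vectors e_i + c e_j: c = 0 gives the diagonal, c = 1 the sum
  and c = \<i> the difference of the two mirrored off-diagonal entries.\<close>

lemma qform_eq_zero_imp:
  fixes A :: "complex^'n^'n"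
  assumes zero: "\<And>x. qform A x = 0"
  shows "A = 0"
proof -
  have "qform A (axis i 1 + axis j c) =
      A $ i $ i + c * A $ i $ j + cnj c * A $ j $ i + cnj c * c * A $ j $ j" for i j and c :: complex
  proof -
    have *: "(\<Sum>k\<in>UNIV. cnj (axis l d $ k) * z $ k) = cnj d * z $ l" for l d and z :: "complex^'n"
      by (subst sum.remove[of _ l]) (auto simp: axis_def intro!: sum.neutral)
    have **: "(A *v axis l d) $ k = d * A $ k $ l" for l k and d :: complex
      by (simp add: matrix_vector_mult_def axis_def if_distrib cong: if_cong)
    have "qform A (axis i 1 + axis j c) =
        (A *v (axis i 1 + axis j c)) $ i + cnj c * (A *v (axis i 1 + axis j c)) $ j"
      unfolding qform_def vector_add_component complex_cnj_add distrib_right sum.distrib *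
      by simp
    then show ?thesis
      by (simp add: matrix_vector_right_distrib ** algebra_simps)
  qed
  note polar = this[unfolded zero]
  have diag: "A $ i $ i = 0" for i
    using polar[of i 0 i] by simp
  have "A $ i $ j = 0" for i j
  proof -
    have "A $ i $ j + A $ j $ i = 0"
      using polar[of i 1 j] diag by simp
    moreover have "A $ i $ j = A $ j $ i"
      using polar[of i \<i> j] diag by (simp add: right_diff_distrib[symmetric])
    ultimately show ?thesis by simp
  qed
  then show ?thesis by (simp add: vec_eq_iff)
qed

lemma qform_eqI:
  assumes "\<And>x. qform A x = qform B x"
  shows "A = B"
  using qform_eq_zero_imp[of "A - B"] assms by (simp add: qform_diff)

text \<open>Boundedness, automatic in finite dimension, lets convergent series of matrices pass to
  the scalar measures.\<close>

lemma bounded_linear_Re_qform: "bounded_linear (\<lambda>A::complex^'n^'n. Re (qform A x))"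
proof -
  have "linear (\<lambda>A::complex^'n^'n. Re (qform A x))"
    by (rule linearI)
      (simp_all add: qform_def matrix_vector_mult_def distrib_left sum.distrib scaleR_sum_right
        sum_distrib_left distrib_right mult.assoc)
  then show ?thesis by (rule linear_conv_bounded_linear[THEN iffD1])
qed

lemma bounded_linear_congruence:
  "bounded_linear (\<lambda>A::complex^'n^'n. R ** A ** cadjoint R :: complex^'m^'m)"
proof -
  have "linear (\<lambda>A::complex^'n^'n. R ** A ** cadjoint R :: complex^'m^'m)"
  proof (rule linearI)
    show "R ** (c *\<^sub>R A) ** cadjoint R = c *\<^sub>R (R ** A ** cadjoint R)" for c A
      by (simp add: matrix_matrix_mult_def vec_eq_iff scaleR_sum_right sum_distrib_right)
  qed (simp add: matrix_add_ldistrib matrix_add_rdistrib)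
  then show ?thesis by (rule linear_conv_bounded_linear[THEN iffD1])
qed

lemma matrix_inv_eqI:
  fixes A B :: "complex^'n^'n"
  assumes "A ** B = mat 1" "B ** A = mat 1"
  shows "matrix_inv A = B"
proof -
  have "A ** matrix_inv A = mat 1 \<and> matrix_inv A ** A = mat 1"
    unfolding matrix_inv_def using assms by (rule_tac someI[of _ B]) simp
  then show ?thesis
    using assms by (metis matrix_mul_assoc matrix_mul_lid matrix_mul_rid)
qed

text \<open>Because \<open>R\<close> is unitary, conjugation by it fixes the identity and respects
  sums and products, hence also inverses.\<close>

lemma herglotz_congruence:
  fixes R X :: "complex^'n^'n"
  assumes R: "unitary_matrix R" and inv: "invertible (mat 1 - X)"
  defines "Y \<equiv> R ** X ** cadjoint R"
  shows "matrix_inv (mat 1 - Y) ** (mat 1 + Y) =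
    R ** (matrix_inv (mat 1 - X) ** (mat 1 + X)) ** cadjoint R"
proof -
  have R1: "R ** cadjoint R = mat 1" and R2: "Z ** cadjoint R ** R = Z" for Z
    using R by (simp_all add: unitary_matrix_def matrix_mul_assoc[symmetric])
  define Z where "Z = matrix_inv (mat 1 - X)"
  have Z: "(mat 1 - X) ** Z = mat 1" "Z ** (mat 1 - X) = mat 1"
    using inv unfolding Z_def invertible_def matrix_inv_def by (metis (mono_tags, lifting) someI)+
  have sub: "mat 1 - Y = R ** (mat 1 - X) ** cadjoint R"
  proof -
    have "R ** (mat 1 - X) ** cadjoint R + Y = R ** (mat 1 - X + X) ** cadjoint R"
      unfolding Y_def by (simp only: matrix_add_ldistrib matrix_add_rdistrib)
    then show ?thesis by (simp add: R1 algebra_simps)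
  qed
  have add: "mat 1 + Y = R ** (mat 1 + X) ** cadjoint R"
    by (simp add: Y_def R1 matrix_add_ldistrib matrix_add_rdistrib)
  have prod: "(R ** A ** cadjoint R) ** (R ** B ** cadjoint R) = R ** (A ** B) ** cadjoint R"
    for A B
    by (simp add: matrix_mul_assoc R2)
  have "matrix_inv (mat 1 - Y) = R ** Z ** cadjoint R"
    unfolding sub by (rule matrix_inv_eqI) (simp_all add: prod Z R1)
  then show ?thesis
    unfolding add prod Z_def by (simp add: prod)
qed

section \<open>Clark measures\<close>

lemma psd_qform:
  assumes "psd_matrix A"
  shows "0 \<le> Re (qform A x)" "qform A x = complex_of_real (Re (qform A x))"
  using assms by (auto simp: psd_matrix_def complex_nonneg_Reals_iff complex_eq_iff)

lemma nonneg_matrix_measure_empty: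
  assumes "nonneg_matrix_measure M \<mu>"
  shows "\<mu> {} = 0"
proof -
  have "(\<lambda>k::nat. \<mu> {}) sums \<mu> (\<Union>k::nat. {})"
    using assms unfolding nonneg_matrix_measure_def
    by (elim conjE allE[of _ "\<lambda>k::nat. {}"]) (simp add: disjoint_family_on_def)
  then have "(\<lambda>k::nat. \<mu> {}) \<longlonglongrightarrow> 0"
    by (simp add: summable_LIMSEQ_zero sums_summable)
  then show ?thesis by (simp add: LIMSEQ_const_iff)
qed

lemma sets_scalar_measure [simp]: "sets (scalar_measure M \<mu> x) = sets M"
  by (simp add: scalar_measure_def)

text \<open>\<open>measure_of\<close> returns the prescribed values only for a countably additive
  set function. Additivity is inherited from the matrix measure, and nonnegativity of the forms
  turns the real series into one in \<open>ennreal\<close>.\<close>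

lemma emeasure_scalar_measure:
  assumes \<mu>: "nonneg_matrix_measure M \<mu>" and A: "A \<in> sets M"
  shows "emeasure (scalar_measure M \<mu> x) A = ennreal (Re (qform (\<mu> A) x))"
  unfolding scalar_measure_def
proof (rule emeasure_measure_of_sigma[OF sets.sigma_algebra_axioms _ _ A])
  interpret L: bounded_linear "\<lambda>A. Re (qform A x)" by (rule bounded_linear_Re_qform)
  show "positive (sets M) (\<lambda>\<Omega>. ennreal (Re (qform (\<mu> \<Omega>) x)))"
    using nonneg_matrix_measure_empty[OF \<mu>] L.zero by (simp add: positive_def)
  show "countably_additive (sets M) (\<lambda>\<Omega>. ennreal (Re (qform (\<mu> \<Omega>) x)))"
  proof (rule countably_additiveI)
    fix E :: "nat \<Rightarrow> _" assume E: "range E \<subseteq> sets M" "disjoint_family E"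
    then have "(\<lambda>k. \<mu> (E k)) sums \<mu> (\<Union>k. E k)"
      using \<mu> by (simp add: nonneg_matrix_measure_def)
    then have "(\<lambda>k. Re (qform (\<mu> (E k)) x)) sums Re (qform (\<mu> (\<Union>k. E k)) x)"
      by (rule L.sums)
    moreover have "0 \<le> Re (qform (\<mu> (E k)) x)" for k
      using \<mu> E by (intro psd_qform) (auto simp: nonneg_matrix_measure_def)
    ultimately show "(\<Sum>k. ennreal (Re (qform (\<mu> (E k)) x))) = ennreal (Re (qform (\<mu> (\<Union>k. E k)) x))"
      by (intro suminf_ennreal_eq)
  qed
qed

lemma finite_circle_measure_scalar:
  assumes "nonneg_matrix_measure unit_circle \<mu>"
  shows "finite_circle_measure (scalar_measure unit_circle \<mu> x)"
proof -
  let ?M = "scalar_measure unit_circle \<mu> x"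
  have "space ?M \<in> sets unit_circle" using sets.top[of ?M] by simp
  then have "emeasure ?M (space ?M) \<noteq> \<infinity>"
    using emeasure_scalar_measure[OF assms] by simp
  then show ?thesis
    by (intro finite_circle_measure.intro finite_circle_measure_axioms.intro finite_measureI) simp_all
qed

text \<open>For every \<open>x\<close> the scalar measure of \<mu>1 at \<open>x\<close> and that of
  \<mu>2 at \<open>cadjoint R *v x\<close> have the same Poisson integral, so they coincide.
  Polarization then recovers the matrices.\<close>

lemma clark_measure_congruence:
  fixes b1 b2 :: "complex \<Rightarrow> complex^'n^'n"
  assumes R: "unitary_matrix R"
    and b: "\<And>\<zeta>. norm \<zeta> < 1 \<Longrightarrow>
      b1 \<zeta> ** cadjoint \<beta>1 = R ** (b2 \<zeta> ** cadjoint \<beta>2) ** cadjoint R"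
    and \<mu>1: "is_clark_measure b1 \<beta>1 \<mu>1" and \<mu>2: "is_clark_measure b2 \<beta>2 \<mu>2"
    and \<Omega>: "\<Omega> \<in> sets unit_circle"
  shows "\<mu>1 \<Omega> = R ** \<mu>2 \<Omega> ** cadjoint R"
proof (rule qform_eqI)
  fix x :: "complex^'n"
  let ?y = "cadjoint R *v x"
  let ?M1 = "scalar_measure unit_circle \<mu>1 x" and ?M2 = "scalar_measure unit_circle \<mu>2 ?y"
  have nn: "nonneg_matrix_measure unit_circle \<mu>1" "nonneg_matrix_measure unit_circle \<mu>2"
    using \<mu>1 \<mu>2 by (simp_all add: is_clark_measure_def)
  interpret M1: finite_circle_measure ?M1 using nn(1) by (rule finite_circle_measure_scalar)
  interpret M2: finite_circle_measure ?M2 using nn(2) by (rule finite_circle_measure_scalar)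
  interpret two_circle_measures ?M1 ?M2
  proof
    fix \<zeta> :: complex assume z: "norm \<zeta> < 1"
    let ?H = "\<lambda>X. Re_matrix (matrix_inv (mat 1 - X) ** (mat 1 + X))"
    let ?X1 = "b1 \<zeta> ** cadjoint \<beta>1" and ?X2 = "b2 \<zeta> ** cadjoint \<beta>2"
    have 1: "qform (?H ?X1) x = complex_of_real (\<integral>t. poisson \<zeta> t \<partial>?M1)"
      using \<mu>1 z by (simp add: is_clark_measure_def matrix_has_integral_def)
    have 2: "qform (?H ?X2) ?y = complex_of_real (\<integral>t. poisson \<zeta> t \<partial>?M2)"
      using \<mu>2 z by (simp add: is_clark_measure_def matrix_has_integral_def)
    have "invertible (mat 1 - ?X2)"
      using \<mu>2 z by (simp add: is_clark_measure_def)
    then have "?H ?X1 = R ** ?H ?X2 ** cadjoint R"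
      unfolding b[OF z] by (simp only: herglotz_congruence[OF R] Re_matrix_congruence)
    then show "(\<integral>t. poisson \<zeta> t \<partial>?M1) = (\<integral>t. poisson \<zeta> t \<partial>?M2)"
      using 1 2 by (simp add: qform_congruence)
  qed
  have psd: "psd_matrix (\<mu>1 \<Omega>)" "psd_matrix (\<mu>2 \<Omega>)"
    using nn \<Omega> by (simp_all add: nonneg_matrix_measure_def)
  have "ennreal (Re (qform (\<mu>1 \<Omega>) x)) = ennreal (Re (qform (\<mu>2 \<Omega>) ?y))"
    using emeasure_scalar_measure[OF nn(1) \<Omega>] emeasure_scalar_measure[OF nn(2) \<Omega>]
    by (metis measures_eq)
  \<comment> \<open>\<open>ennreal\<close> truncates negative numbers to 0, so nonnegativity of both
    forms is what allows it to be removed.\<close>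
  then have "Re (qform (\<mu>1 \<Omega>) x) = Re (qform (\<mu>2 \<Omega>) ?y)"
    using psd by (simp add: psd_qform(1))
  then show "qform (\<mu>1 \<Omega>) x = qform (R ** \<mu>2 \<Omega> ** cadjoint R) x"
    unfolding qform_congruence using psd psd_qform(2) by metis
qed

section \<open>The Cayley transform and the passage to the line\<close>

lemma ball_subset_cayley_image: "ball 0 1 \<subseteq> cayley ` upper_halfplane"
proof
  fix \<zeta> :: complex assume "\<zeta> \<in> ball 0 1"
  then have z: "norm \<zeta> < 1" by simp
  then have ne: "1 - \<zeta> \<noteq> 0" by auto
  \<comment> \<open>This is the inverse Cayley transform; its imaginary part is (1 - |\<zeta>|^2) /
    |1 - \<zeta>|^2.\<close>
  define w where "w = \<i> * (1 + \<zeta>) / (1 - \<zeta>)"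
  have "(Re \<zeta>)\<^sup>2 + (Im \<zeta>)\<^sup>2 < 1"
    using z by (simp add: cmod_power2[symmetric] power_less_one_iff abs_square_less_1)
  moreover have "(1 - Re \<zeta>)\<^sup>2 + (Im \<zeta>)\<^sup>2 > 0"
    using ne by (auto simp: complex_eq_iff sum_power2_gt_zero_iff)
  ultimately have "Im w > 0"
    by (simp add: w_def Im_divide power2_eq_square algebra_simps)
  moreover have "cayley w = \<zeta>"
  proof -
    have "w - \<i> = 2 * \<i> * \<zeta> / (1 - \<zeta>)" "w + \<i> = 2 * \<i> / (1 - \<zeta>)"
      using ne by (simp_all add: w_def field_simps)
    then show ?thesis using ne by (simp add: cayley_def)
  qed
  ultimately show "\<zeta> \<in> cayley ` upper_halfplane"
    by (auto simp: upper_halfplane_def)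
qed

text \<open>The image is rewritten as a preimage under the inverse map, for which measurability is
  immediate.\<close>

lemma cayley_image_sets:
  assumes "\<Omega> \<in> sets borel"
  shows "(\<lambda>s. cayley (complex_of_real s)) ` \<Omega> \<in> sets unit_circle"
proof -
  \<comment> \<open>The real part makes the inverse Cayley transform a real function on the whole
    plane. Division by zero gives \<open>h 1 = 0\<close>, so the point 1 has to be removed from
    preimages.\<close>
  define h where "h z = Re (\<i> * (1 + z) / (1 - z))" for z
  have [measurable]: "h \<in> borel_measurable borel"
    unfolding h_def by measurable
  have hc: "h (cayley (complex_of_real s)) = s" for s
  proof -
    have ne: "complex_of_real s + \<i> \<noteq> 0" by (simp add: complex_eq_iff)
    have "1 + cayley s = 2 * s / (s + \<i>)" "1 - cayley s = 2 * \<i> / (s + \<i>)"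
      using ne by (simp_all add: cayley_def field_simps)
    then show ?thesis using ne by (simp add: h_def)
  qed
  have norm: "norm (cayley (complex_of_real s)) = 1" for s
  proof -
    have "norm (complex_of_real s - \<i>) = norm (complex_of_real s + \<i>)"
      by (simp add: cmod_def)
    moreover have "complex_of_real s + \<i> \<noteq> 0" by (simp add: complex_eq_iff)
    ultimately show ?thesis by (simp add: cayley_def norm_divide)
  qed
  have ne1: "cayley (complex_of_real s) \<noteq> 1" for s
  proof
    assume "cayley s = 1"
    moreover have "complex_of_real s + \<i> \<noteq> 0" by (simp add: complex_eq_iff)
    ultimately have "complex_of_real s - \<i> = complex_of_real s + \<i>"
      by (simp add: cayley_def)
    then show False by (simp add: complex_eq_iff)
  qed
  have surj: "cayley (complex_of_real (h z)) = z" if z: "norm z = 1" "z \<noteq> 1" for z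
  proof -
    have "z \<noteq> 0" using z by auto
    moreover have "z * cnj z = 1"
      using z by (simp add: complex_norm_square[symmetric])
    ultimately have "cnj z = 1 / z" by (simp add: field_simps)
    \<comment> \<open>With conjugate 1/z, the inverse Cayley transform of \<open>z\<close> equals
      its own conjugate and is therefore real.\<close>
    then have "cnj (\<i> * (1 + z) / (1 - z)) = \<i> * (1 + z) / (1 - z)"
      using z \<open>z \<noteq> 0\<close> by (simp add: field_simps)
    then have "complex_of_real (h z) = \<i> * (1 + z) / (1 - z)"
      by (metis h_def complex_cnj_cancel_iff Reals_cnj_iff of_real_Re)
    then have "h z - \<i> = 2 * \<i> * z / (1 - z)" "h z + \<i> = 2 * \<i> / (1 - z)"
      using z by (simp_all add: field_simps)
    then show ?thesis using z by (simp add: cayley_def)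
  qed
  have "(\<lambda>s. cayley (complex_of_real s)) ` \<Omega> = sphere 0 1 \<inter> (h -` \<Omega> - {1})"
    using hc norm ne1 surj by (auto simp: image_iff) metis
  moreover have "h -` \<Omega> - {1} \<in> sets borel"
    using measurable_sets[of h borel borel \<Omega>] assms by auto
  ultimately show ?thesis
    by (auto simp: sets_restrict_space)
qed

text \<open>\<open>to_disk\<close> evaluates both functions at the same chosen preimage of \<zeta>,
  which lies in the half-plane because \<open>cayley\<close> covers the disk. The relation between
  \<open>B1\<close> and \<open>B2\<close> thus passes to the disk.\<close>

lemma clark_measure_line_congruence:
  fixes B1 B2 :: "complex \<Rightarrow> complex^'n^'n"
  assumes R: "unitary_matrix R"
    and B: "\<And>w. w \<in> upper_halfplane \<Longrightarrow>
      B1 w ** cadjoint \<beta>1 = R ** (B2 w ** cadjoint \<beta>2) ** cadjoint R"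
    and \<nu>1: "is_clark_measure_line B1 \<beta>1 \<nu>1" and \<nu>2: "is_clark_measure_line B2 \<beta>2 \<nu>2"
    and \<Omega>: "\<Omega> \<in> sets borel"
  shows "\<nu>1 \<Omega> = R ** \<nu>2 \<Omega> ** cadjoint R"
proof -
  let ?c = "\<lambda>\<Omega>. (\<lambda>s. cayley (complex_of_real s)) ` \<Omega>"
  obtain \<mu>1 \<mu>2 where
    \<mu>1: "is_clark_measure (to_disk B1) \<beta>1 \<mu>1" "\<nu>1 \<Omega> = \<mu>1 (?c \<Omega>)" and
    \<mu>2: "is_clark_measure (to_disk B2) \<beta>2 \<mu>2" "\<nu>2 \<Omega> = \<mu>2 (?c \<Omega>)"
    using \<nu>1 \<nu>2 \<Omega> unfolding is_clark_measure_line_def by blast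
  have "to_disk B1 \<zeta> ** cadjoint \<beta>1 = R ** (to_disk B2 \<zeta> ** cadjoint \<beta>2) ** cadjoint R"
    if "norm \<zeta> < 1" for \<zeta>
  proof -
    have "\<zeta> \<in> cayley ` upper_halfplane" using that ball_subset_cayley_image by auto
    then show ?thesis unfolding to_disk_def by (intro B inv_into_into)
  qed
  from clark_measure_congruence[OF R this \<mu>1(1) \<mu>2(1) cayley_image_sets[OF \<Omega>]]
  show ?thesis by (simp add: \<mu>1 \<mu>2)
qed

section \<open>Lebesgue weights\<close>

lemma set_integral_bounded_linear:
  fixes T :: "'b::{banach, second_countable_topology} \<Rightarrow> 'c::{banach, second_countable_topology}"
  assumes "bounded_linear T" and W: "integrable M W" and "A \<in> sets M"
  shows "(LINT s:A|M. T (W s)) = T (LINT s:A|M. W s)"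
proof -
  interpret bounded_linear T by fact
  have "(LINT s:A|M. T (W s)) = (\<integral>s. T (indicator A s *\<^sub>R W s) \<partial>M)"
    by (simp add: set_lebesgue_integral_def scaleR)
  also have "\<dots> = T (LINT s:A|M. W s)"
    unfolding set_lebesgue_integral_def
    by (intro integral_bounded_linear[OF assms(1)] integrable_mult_indicator assms)
  finally show ?thesis .
qed

text \<open>On a set missing \<open>N\<close> the singular part takes its value at the empty set,
  which is 0.\<close>

lemma lebesgue_weight_eq_off_null:
  assumes "is_lebesgue_weight \<nu> W"
  obtains N where "N \<in> null_sets lborel"
    "\<And>\<Omega>. \<Omega> \<in> sets borel \<Longrightarrow> \<Omega> \<inter> N = {} \<Longrightarrow> \<nu> \<Omega> = (LINT s:\<Omega>|lborel. W s)"
proof -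
  obtain \<sigma> N where \<sigma>: "nonneg_matrix_measure borel \<sigma>" and N: "N \<in> null_sets lborel"
    and conc: "\<And>\<Omega>. \<Omega> \<in> sets borel \<Longrightarrow> \<sigma> \<Omega> = \<sigma> (\<Omega> \<inter> N)"
    and \<nu>: "\<And>\<Omega>. \<Omega> \<in> sets borel \<Longrightarrow> \<nu> \<Omega> = (LINT s:\<Omega>|lborel. W s) + \<sigma> \<Omega>"
    using assms unfolding is_lebesgue_weight_def by blast
  have "\<nu> \<Omega> = (LINT s:\<Omega>|lborel. W s)" if "\<Omega> \<in> sets borel" "\<Omega> \<inter> N = {}" for \<Omega>
    using that conc[of \<Omega>] \<nu>[of \<Omega>] nonneg_matrix_measure_empty[OF \<sigma>] by simp
  with N show ?thesis using that by blast
qed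

text \<open>Off the union of the two null sets both singular parts vanish, and removing that union
  changes no Lebesgue integral. Hence \<open>W1\<close> and the image of \<open>W2\<close> under
  \<open>T\<close> have equal integrals over every Borel set, which determines a density almost
  everywhere.\<close>

lemma lebesgue_weight_bounded_linear:
  fixes T :: "complex^'n^'n \<Rightarrow> complex^'n^'n"
  assumes T: "bounded_linear T"
    and \<nu>: "\<And>\<Omega>. \<Omega> \<in> sets borel \<Longrightarrow> \<nu>1 \<Omega> = T (\<nu>2 \<Omega>)"
    and W1: "is_lebesgue_weight \<nu>1 W1" and W2: "is_lebesgue_weight \<nu>2 W2"
  shows "AE s in lborel. W1 s = T (W2 s)"
proof -
  have int: "integrable lborel W1" "integrable lborel W2"
    using W1 W2 by (simp_all add: is_lebesgue_weight_def)
  obtain N1 where N1: "N1 \<in> null_sets lborel"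
    "\<And>\<Omega>. \<Omega> \<in> sets borel \<Longrightarrow> \<Omega> \<inter> N1 = {} \<Longrightarrow> \<nu>1 \<Omega> = (LINT s:\<Omega>|lborel. W1 s)"
    using lebesgue_weight_eq_off_null[OF W1] by blast
  obtain N2 where N2: "N2 \<in> null_sets lborel"
    "\<And>\<Omega>. \<Omega> \<in> sets borel \<Longrightarrow> \<Omega> \<inter> N2 = {} \<Longrightarrow> \<nu>2 \<Omega> = (LINT s:\<Omega>|lborel. W2 s)"
    using lebesgue_weight_eq_off_null[OF W2] by blast
  show ?thesis
  proof (rule sigma_finite_measure.density_unique_banach[OF lborel.sigma_finite_measure_axioms int(1) integrable_bounded_linear[OF T int(2)]])
    fix A :: "real set" assume "A \<in> sets lborel"
    define A' where "A' = A - (N1 \<union> N2)"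
    have A': "A' \<in> sets borel"
      using \<open>A \<in> sets lborel\<close> N1(1) N2(1) by (auto simp: A'_def null_sets_def)
    have off: "(LINT s:A|lborel. f s) = (LINT s:A'|lborel. f s)"
      if "integrable lborel f" for f :: "real \<Rightarrow> complex^'n^'n"
      unfolding set_lebesgue_integral_def
    proof (rule integral_cong_AE)
      show "(\<lambda>s. indicator A s *\<^sub>R f s) \<in> borel_measurable lborel"
        "(\<lambda>s. indicator A' s *\<^sub>R f s) \<in> borel_measurable lborel"
        using that \<open>A \<in> sets lborel\<close> A'
        by (auto intro!: borel_measurable_scaleR borel_measurable_indicator)
      have "AE s in lborel. s \<notin> N1 \<union> N2"
        using N1(1) N2(1) by (intro AE_not_in) auto
      then show "AE s in lborel. indicator A s *\<^sub>R f s = indicator A' s *\<^sub>R f s"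
        by eventually_elim (simp add: A'_def indicator_def)
    qed
    have "(LINT s:A'|lborel. W1 s) = T (LINT s:A'|lborel. W2 s)"
      using N1(2)[OF A'] N2(2)[OF A'] \<nu>[OF A'] by (simp add: A'_def Int_Un_distrib Diff_Int_distrib2)
    also have "\<dots> = (LINT s:A'|lborel. T (W2 s))"
      using A' by (simp add: set_integral_bounded_linear[OF T int(2)])
    finally show "(LINT s:A|lborel. W1 s) = (LINT s:A|lborel. T (W2 s))"
      by (simp only: off[OF int(1)] off[OF integrable_bounded_linear[OF T int(2)]])
  qed
qed

theorem theorem5:
  fixes \<alpha> R Q :: "complex^'n^'n"
    and B1 B2 :: "complex \<Rightarrow> complex^'n^'n"
    and \<mu>1 \<mu>2 :: "real set \<Rightarrow> complex^'n^'n"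
    and W1 W2 :: "real \<Rightarrow> complex^'n^'n"
  assumes "unitary_matrix \<alpha>" and "unitary_matrix R" and "unitary_matrix Q"
    and "B1 \<in> schur_class upper_halfplane" and "B2 \<in> schur_class upper_halfplane"
    and "\<forall>w\<in>upper_halfplane. B1 w = R ** B2 w ** Q"
    and "is_clark_measure_line B1 \<alpha> \<mu>1"
    and "is_clark_measure_line B2 (cadjoint R ** \<alpha> ** cadjoint Q) \<mu>2"
    and "is_lebesgue_weight \<mu>1 W1"
    and "is_lebesgue_weight \<mu>2 W2"
  shows "AE s in lborel. W1 s = R ** W2 s ** cadjoint R"
proof -
  have "B1 w ** cadjoint \<alpha> =
      R ** (B2 w ** cadjoint (cadjoint R ** \<alpha> ** cadjoint Q)) ** cadjoint R"
    if "w \<in> upper_halfplane" for w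
  proof -
    \<comment> \<open>The adjoint of the parameter is \<open>Q ** cadjoint \<alpha> ** R\<close>,
      whose trailing \<open>R\<close> cancels against \<open>cadjoint R\<close>.\<close>
    have "R ** (B2 w ** cadjoint (cadjoint R ** \<alpha> ** cadjoint Q)) ** cadjoint R =
        R ** B2 w ** Q ** cadjoint \<alpha> ** (R ** cadjoint R)"
      by (simp add: cadjoint_mult matrix_mul_assoc)
    then show ?thesis
      using that assms(2,6) by (simp add: unitary_matrix_def)
  qed
  from clark_measure_line_congruence[OF assms(2) this assms(7,8)]
  show ?thesis
    using lebesgue_weight_bounded_linear[OF bounded_linear_congruence _ assms(9,10)] by blast
qed

end
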